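(* Let $G$ be a 2-regular graph on $n$ vertices. Then there are at least $(n-2)!/4$ compatible cycles for $G$. If, in addition, every cycle of $G$ has even length, then there are at least $(n-2)!/2$ compatible cycles for $G$.
   Context: Graphs are finite, loopless, and may have multiple edges; vertices are labelled. A graph is 2-regular if every vertex has degree 2; thus a 2-regular graph is a vertex-disjoint collection of cycles, where a pair of vertices joined by a double edge counts as a cycle of length 2. For two graphs $G_1,G_2$ on the same vertex set, $G_1\cup G_2$ denotes the graph on that vertex set whose edge multiset is the disjoint union of the edges of $G_1$ and of $G_2$ (so an edge occurring in both becomes a double edge; multiplicities add). A "cycle on a vertex set $V$" is a connected 2-regular graph with vertex set $V$ (i.e. it passes through every vertex of $V$ exactly once). Given a 2-regular graph $G$ on a vertex set $V$, a compatible cycle for $G$ is a cycle $C$ on $V$ (not necessarily a subgraph of $G$) such that the 4-regular graph $G\cup C$ admits a hamiltonian decomposition, i.e. $G\cup C=C_1\cup C_2$ (as edge multisets) for some cycles $C_1$ and $C_2$ on the vertex set $V$. Compatible cycles are counted as labelled graphs on $V$. *)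

theory Defs
  imports Complex_Main "HOL-Library.Multiset"
begin

text \<open>
  A loopless multigraph is a finite vertex set together with a multiset of 2-element subsets of it.
  Parallel edges carry no identity of their own: labelled graphs on a fixed vertex set are equal iff
  their edge multisets are, so counting labelled graphs means counting edge multisets.
  Multiset addition of edge multisets is the multiplicity-adding union of graphs.
\<close>

definition multigraph :: "'a set \<Rightarrow> 'a set multiset \<Rightarrow> bool" where
  "multigraph V E \<longleftrightarrow> finite V \<and> (\<forall>e \<in># E. e \<subseteq> V \<and> card e = 2)"

definition vertex_degree :: "'a set multiset \<Rightarrow> 'a \<Rightarrow> nat" where
  "vertex_degree E v = size {# e \<in># E. v \<in> e #}"

definition two_regular :: "'a set \<Rightarrow> 'a set multiset \<Rightarrow> bool" where
  "two_regular V E \<longleftrightarrow> multigraph V E \<and> (\<forall>v \<in> V. vertex_degree E v = 2)"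

definition adjacency :: "'a set multiset \<Rightarrow> ('a \<times> 'a) set" where
  "adjacency E = {(u, v). {u, v} \<in># E}"

definition connected_graph :: "'a set \<Rightarrow> 'a set multiset \<Rightarrow> bool" where
  "connected_graph V E \<longleftrightarrow> V \<noteq> {} \<and> (\<forall>u \<in> V. \<forall>v \<in> V. (u, v) \<in> (adjacency E)\<^sup>*)"

text \<open>On a two-element vertex set the only cycle is the double edge, of length 2.\<close>

definition cycle_on :: "'a set \<Rightarrow> 'a set multiset \<Rightarrow> bool" where
  "cycle_on V C \<longleftrightarrow> two_regular V C \<and> connected_graph V C"

definition hamiltonian_decomposable :: "'a set \<Rightarrow> 'a set multiset \<Rightarrow> bool" where
  "hamiltonian_decomposable V H \<longleftrightarrow>
     (\<exists>C\<^sub>1 C\<^sub>2. cycle_on V C\<^sub>1 \<and> cycle_on V C\<^sub>2 \<and> H = C\<^sub>1 + C\<^sub>2)"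

definition compatible_cycle :: "'a set \<Rightarrow> 'a set multiset \<Rightarrow> 'a set multiset \<Rightarrow> bool" where
  "compatible_cycle V G C \<longleftrightarrow> cycle_on V C \<and> hamiltonian_decomposable V (G + C)"

text \<open>A cycle of \<open>G\<close> is a subgraph of \<open>G\<close> that is a cycle on its own vertex set.\<close>

definition cycle_of :: "'a set \<Rightarrow> 'a set multiset \<Rightarrow> 'a set \<Rightarrow> 'a set multiset \<Rightarrow> bool" where
  "cycle_of V G W D \<longleftrightarrow> W \<subseteq> V \<and> D \<subseteq># G \<and> cycle_on W D"

end

theory Submission
  imports Defs
begin

text \<open>
  Colour the edges of \<open>G\<close> with two colours, \<open>G = A + B\<close>. A pair \<open>(M, N)\<close> such that \<open>A + M\<close>, \<open>B + N\<close> and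
  \<open>M + N\<close> are cycles on \<open>V\<close> yields the compatible cycle \<open>M + N\<close>. If \<open>A\<close> and \<open>B\<close> are perfect matchings on
  \<open>2m\<close> vertices, joining \<open>v\<close> to an admissible partner and contracting shows that there are at least
  \<open>(2m - 2)!!\<close> choices of \<open>M\<close>, and at least \<open>(2m - 3)!!\<close> choices of \<open>N\<close> for each of them. For odd cycles,
  choose in each of the \<open>k\<close> odd cycles a centre, at which both edges get the same, freely chosen,
  colour. A centre with two edges in \<open>A\<close> can be inserted into any edge of \<open>N\<close>, so that \<open>r\<close> centres of
  one colour and \<open>s\<close> of the other give at least \<open>(2m - 2)! m\<^sup>(\<^sup>r\<^sup>) m\<^sup>(\<^sup>s\<^sup>)\<close> pairs, in rising factorials.
  Summing over the \<open>2\<^sup>k\<close> colourings gives \<open>(2m - 2)! (2m)\<^sup>(\<^sup>k\<^sup>)\<close> by Vandermonde's identity, which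
  is at least \<open>(n - 2)!\<close> because \<open>n = 2m + k\<close>, and every cycle arises at most twice.
\<close>

section \<open>Degrees\<close>

lemma vertex_degree_empty [simp]: "vertex_degree {#} v = 0"
  by (simp add: vertex_degree_def)

lemma vertex_degree_add_mset [simp]:
  "vertex_degree (add_mset e E) v = (if v \<in> e then Suc (vertex_degree E v) else vertex_degree E v)"
  by (simp add: vertex_degree_def)

lemma vertex_degree_plus [simp]:
  "vertex_degree (E + F) v = vertex_degree E v + vertex_degree F v"
  by (simp add: vertex_degree_def)

lemma multigraph_empty [simp]: "multigraph V {#} \<longleftrightarrow> finite V"
  by (simp add: multigraph_def)

lemma multigraph_add_mset [simp]:
  "multigraph V (add_mset e E) \<longleftrightarrow> e \<subseteq> V \<and> card e = 2 \<and> multigraph V E"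
  by (auto simp: multigraph_def)

lemma multigraph_plus [simp]:
  "multigraph V (E + F) \<longleftrightarrow> multigraph V E \<and> multigraph V F"
  by (auto simp: multigraph_def)

lemma multigraph_finite: "multigraph V E \<Longrightarrow> finite V"
  by (simp add: multigraph_def)

lemma multigraph_mono: "multigraph V E \<Longrightarrow> V \<subseteq> W \<Longrightarrow> finite W \<Longrightarrow> multigraph W E"
  by (auto simp: multigraph_def)

lemma multigraph_subset_mset: "multigraph V E \<Longrightarrow> F \<subseteq># E \<Longrightarrow> multigraph V F"
  by (auto simp: multigraph_def dest: mset_subset_eqD)

lemma vertex_degree_eq_0_iff: "vertex_degree E v = 0 \<longleftrightarrow> (\<forall>e\<in>#E. v \<notin> e)"
  by (auto simp: vertex_degree_def filter_mset_eq_mempty_iff)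

lemma vertex_degree_outside: "multigraph V E \<Longrightarrow> v \<notin> V \<Longrightarrow> vertex_degree E v = 0"
  by (auto simp: multigraph_def vertex_degree_eq_0_iff)

lemma multigraph_remove_vertices:
  assumes "multigraph V E" "\<And>v. v \<in> X \<Longrightarrow> vertex_degree E v = 0"
  shows "multigraph (V - X) E"
  using assms unfolding multigraph_def vertex_degree_eq_0_iff by blast

lemma vertex_degree_mono: "F \<subseteq># E \<Longrightarrow> vertex_degree F v \<le> vertex_degree E v"
  by (auto simp: subset_mset.le_iff_add)

lemma count_le_vertex_degree:
  assumes "v \<in> e"
  shows "count E e \<le> vertex_degree E v"
  using assms by (induction E) auto

lemma handshake:
  assumes "multigraph V E"
  shows "(\<Sum>v\<in>V. vertex_degree E v) = 2 * size E"
  using assms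
proof (induction E)
  case empty
  then show ?case by simp
next
  case (add e E)
  have V: "finite V" and e: "e \<subseteq> V" "card e = 2" and E: "multigraph V E"
    using add.prems by (auto simp: multigraph_def)
  have "(\<Sum>v\<in>V. vertex_degree (add_mset e E) v)
      = (\<Sum>v\<in>V. vertex_degree E v + (if v \<in> e then 1 else 0))"
    by (intro sum.cong) auto
  also have "\<dots> = 2 * size E + card (V \<inter> e)"
    using add.IH[OF E] V by (simp add: sum.distrib sum.If_cases)
  also have "V \<inter> e = e" using e by blast
  finally show ?case using e by simp
qed

lemma edge_obtain_other:
  assumes "card e = 2" "v \<in> e"
  obtains w where "w \<noteq> v" "e = {v, w}"
  using assms unfolding card_2_iff by (metis doubleton_eq_iff insert_iff singletonD)

lemma obtain_edge_at:
  assumes "multigraph V E" "vertex_degree E v = Suc k"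
  obtains w E' where "E = add_mset {v, w} E'" "w \<noteq> v" "w \<in> V" "vertex_degree E' v = k"
proof -
  obtain e where "e \<in># E" "v \<in> e"
    using assms vertex_degree_eq_0_iff[of E v] by force
  then obtain E' where E': "E = add_mset e E'"
    by (meson multi_member_split)
  obtain w where "w \<noteq> v" "e = {v, w}"
    using edge_obtain_other[of e v] assms(1) \<open>v \<in> e\<close> unfolding E' by auto
  then show thesis using that[of w E'] assms E' by auto
qed

section \<open>Cycles and subdivision\<close>

lemma cycle_on_finite: "cycle_on V C \<Longrightarrow> finite V"
  by (simp add: cycle_on_def two_regular_def multigraph_def)

lemma cycle_on_multigraph: "cycle_on V C \<Longrightarrow> multigraph V C"
  by (simp add: cycle_on_def two_regular_def)

lemma cycle_on_degree: "cycle_on V C \<Longrightarrow> v \<in> V \<Longrightarrow> vertex_degree C v = 2"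
  by (simp add: cycle_on_def two_regular_def)

lemma cycle_on_digon: "a \<noteq> b \<Longrightarrow> cycle_on {a, b} {#{a, b}, {a, b}#}"
  by (auto simp: cycle_on_def two_regular_def connected_graph_def adjacency_def insert_commute
      intro!: r_into_rtrancl)

text \<open>The new vertex has degree 2, all other degrees stay as they were, and an old walk that
  steps between \<open>a\<close> and \<open>b\<close> takes the detour through \<open>v\<close>
  instead.\<close>

lemma cycle_on_subdivide:
  assumes C: "cycle_on V (add_mset {a, b} X)" and v: "v \<notin> V"
  shows "cycle_on (insert v V) (add_mset {a, v} (add_mset {v, b} X))"
proof -
  let ?D = "add_mset {a, v} (add_mset {v, b} X)"
  have X: "multigraph V X" and ab: "a \<in> V" "b \<in> V" "a \<noteq> b" and fin: "finite V"
    using cycle_on_multigraph[OF C] by (auto simp: card_2_iff doubleton_eq_iff multigraph_finite)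
  have "multigraph (insert v V) ?D"
    using ab v fin multigraph_mono[OF X, of "insert v V"] by (auto simp: card_2_iff)
  moreover have "vertex_degree ?D u = 2" if "u \<in> insert v V" for u
    using that cycle_on_degree[OF C, of u] vertex_degree_outside[OF X v] ab v by auto
  moreover have "connected_graph (insert v V) ?D"
  proof -
    have sym: "sym (adjacency ?D)"
      by (auto simp: sym_def adjacency_def insert_commute)
    have av: "(a, v) \<in> adjacency ?D" "(v, b) \<in> adjacency ?D"
      by (auto simp: adjacency_def)
    then have va: "(v, a) \<in> adjacency ?D" "(b, v) \<in> adjacency ?D"
      using sym by (auto dest: symD)
    have "adjacency (add_mset {a, b} X) \<subseteq> (adjacency ?D)\<^sup>*"
    proof clarify
      fix x y assume "(x, y) \<in> adjacency (add_mset {a, b} X)"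
      then consider "(x, y) \<in> adjacency ?D" | "x = a" "y = b" | "x = b" "y = a"
        by (auto simp: adjacency_def doubleton_eq_iff)
      then show "(x, y) \<in> (adjacency ?D)\<^sup>*"
        by cases (use av va in \<open>auto intro: converse_rtrancl_into_rtrancl r_into_rtrancl\<close>)
    qed
    then have old: "(x, y) \<in> (adjacency ?D)\<^sup>*" if "x \<in> V" "y \<in> V" for x y
      using C that rtrancl_subset_rtrancl
      unfolding cycle_on_def connected_graph_def by blast
    have "(a, x) \<in> (adjacency ?D)\<^sup>* \<and> (x, a) \<in> (adjacency ?D)\<^sup>*" if "x \<in> insert v V" for x
      using that old ab av va by auto
    then show ?thesis
      unfolding connected_graph_def by (meson insert_not_empty rtrancl_trans)
  qed
  ultimately show ?thesis by (simp add: cycle_on_def two_regular_def)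
qed

text \<open>The two copies of \<open>e\<close> exhaust the degree of both its ends, so a walk that
  starts in \<open>e\<close> never leaves it; connectedness then gives the claim.\<close>

lemma cycle_on_double_edge:
  assumes C: "cycle_on V C" and e: "count C e \<ge> 2"
  shows "V = e"
proof -
  have "e \<in># C" using e by (metis count_greater_zero_iff not_numeral_le_zero not_gr_zero)
  then have "card e = 2" and eV: "e \<subseteq> V"
    using cycle_on_multigraph[OF C] by (auto simp: multigraph_def)
  then obtain x where "x \<in> e" by fastforce
  have closed: "f = e" if "f \<in># C" "u \<in> f" "u \<in> e" for f u
  proof (rule ccontr)
    assume "f \<noteq> e"
    have "u \<in> V" using that eV by blast
    obtain C' where C': "C = add_mset f C'" using \<open>f \<in># C\<close> by (meson multi_member_split)
    have "count C' e \<le> vertex_degree C' u" by (rule count_le_vertex_degree[OF \<open>u \<in> e\<close>])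
    moreover have "vertex_degree C u = 2" by (rule cycle_on_degree[OF C \<open>u \<in> V\<close>])
    ultimately show False using e \<open>f \<noteq> e\<close> \<open>u \<in> f\<close> unfolding C' by simp
  qed
  have "y \<in> e" if "(x, y) \<in> (adjacency C)\<^sup>*" for y
    using that
  proof (induction rule: rtrancl_induct)
    case base
    then show ?case by fact
  next
    case (step y z)
    then show ?case using closed[of "{y, z}" y] by (auto simp: adjacency_def)
  qed
  then show ?thesis
    using C \<open>x \<in> e\<close> eV unfolding cycle_on_def connected_graph_def by blast
qed

lemma size_cycle_on:
  assumes "cycle_on V C"
  shows "size C = card V"
  using handshake[OF cycle_on_multigraph[OF assms]] cycle_on_degree[OF assms] by simp

text \<open>A cycle is the multiset of a list of fixed length over the finite set
  \<open>Pow V\<close>. Since \<open>card\<close> is 0 on infinite sets, the lower bounds below rest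
  on this finiteness.\<close>

lemma finite_cycles: "finite {C. cycle_on V C}"
proof (cases "finite V")
  case True
  have "{C. cycle_on V C} \<subseteq> mset ` {xs. set xs \<subseteq> Pow V \<and> length xs = card V}"
  proof clarify
    fix C assume C: "cycle_on V C"
    obtain xs where xs: "mset xs = C" using ex_mset by blast
    have "set xs \<subseteq> Pow V"
      using cycle_on_multigraph[OF C] unfolding xs[symmetric] multigraph_def by auto
    moreover have "length xs = card V"
      using size_cycle_on[OF C] unfolding xs[symmetric] by simp
    ultimately show "C \<in> mset ` {xs. set xs \<subseteq> Pow V \<and> length xs = card V}"
      using xs by blast
  qed
  moreover have "finite {xs. set xs \<subseteq> Pow V \<and> length xs = card V}"
    using True by (intro finite_lists_length_eq) simp
  ultimately show ?thesis using finite_surj by blast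
next
  case False
  then have "{C. cycle_on V C} = {}" by (auto dest: cycle_on_finite)
  then show ?thesis by simp
qed

section \<open>Completing perfect matchings to cycles\<close>

definition perfect_matching :: "'a set \<Rightarrow> 'a set multiset \<Rightarrow> bool" where
  "perfect_matching V P \<longleftrightarrow> multigraph V P \<and> (\<forall>v\<in>V. vertex_degree P v = 1)"

text \<open>There are two uses: \<open>P = Q = A\<close> yields the first matching \<open>M\<close>,
  while \<open>P = B\<close> and \<open>Q = M\<close> yield the second matching
  \<open>N\<close>.\<close>

definition completions :: "'a set \<Rightarrow> 'a set multiset \<Rightarrow> 'a set multiset \<Rightarrow> 'a set multiset set" where
  "completions V P Q = {M. cycle_on V (P + M) \<and> cycle_on V (Q + M)}"

lemma finite_completions: "finite (completions V P Q)"
proof -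
  have "(\<lambda>M. P + M) ` completions V P Q \<subseteq> {C. cycle_on V C}"
    by (auto simp: completions_def)
  then have "finite ((\<lambda>M. P + M) ` completions V P Q)"
    using finite_cycles finite_subset by blast
  then show ?thesis by (rule finite_imageD) simp
qed

lemma perfect_matching_partner:
  assumes "perfect_matching V P" "v \<in> V"
  obtains p where "\<And>w. {v, w} \<in># P \<longleftrightarrow> w = p"
proof -
  obtain p P' where P: "P = add_mset {v, p} P'" "p \<noteq> v" "p \<in> V" "vertex_degree P' v = 0"
  proof (rule obtain_edge_at[of V P v 0])
    show "multigraph V P" "vertex_degree P v = Suc 0"
      using assms by (auto simp: perfect_matching_def)
  qed blast
  have "{v, w} \<in># P \<longleftrightarrow> w = p" for w
    using P by (auto simp: vertex_degree_eq_0_iff doubleton_eq_iff)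
  then show thesis using that by blast
qed

text \<open>Let \<open>p\<close> and \<open>q\<close> be the partners of \<open>v\<close> and
  \<open>w\<close>. The matching \<open>P'\<close> joins \<open>p\<close> to \<open>q\<close>
  directly; subdividing this edge by \<open>v\<close> and then by \<open>w\<close> turns it into the
  path \<open>p\<close>, \<open>v\<close>, \<open>w\<close>, \<open>q\<close>, whose middle edge is
  the added one.\<close>

lemma perfect_matching_contract:
  assumes P: "perfect_matching V P" and vw: "v \<in> V" "w \<in> V" "v \<noteq> w" "{v, w} \<notin># P"
  obtains P' where "perfect_matching (V - {v, w}) P'"
    "\<And>M. cycle_on (V - {v, w}) (P' + M) \<Longrightarrow> cycle_on V (P + add_mset {v, w} M)"
proof -
  have PV: "multigraph V P" and Pd: "\<And>u. u \<in> V \<Longrightarrow> vertex_degree P u = 1"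
    using P by (auto simp: perfect_matching_def)
  obtain p P1 where P1: "P = add_mset {v, p} P1" "p \<noteq> v" "p \<in> V" "vertex_degree P1 v = 0"
    using obtain_edge_at[OF PV, of v 0] Pd vw by auto
  have pw: "p \<noteq> w" using P1 vw by auto
  have "vertex_degree P1 w = Suc 0" using Pd[of w] P1 vw pw by auto
  then obtain q P2 where P2: "P1 = add_mset {w, q} P2" "q \<noteq> w" "q \<in> V" "vertex_degree P2 w = 0"
    using obtain_edge_at[of V P1 w 0] PV P1 by auto
  have qv: "q \<noteq> v" using P1 P2 by auto
  have pq: "p \<noteq> q"
    using Pd[of p] P1 P2 by (auto split: if_splits)
  let ?P = "add_mset {p, q} P2"
  have v0: "vertex_degree P2 v = 0" using P1 P2 by (auto split: if_splits)
  have "multigraph (V - {v, w}) ?P"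
    using multigraph_remove_vertices[of V P2 "{v, w}"] PV P1 P2 v0 qv pw pq by auto
  moreover have "vertex_degree ?P u = 1" if "u \<in> V - {v, w}" for u
    using Pd[of u] that P1 P2 pq by (auto split: if_splits)
  ultimately have "perfect_matching (V - {v, w}) ?P"
    by (simp add: perfect_matching_def)
  moreover have "cycle_on V (P + add_mset {v, w} M)" if "cycle_on (V - {v, w}) (?P + M)" for M
  proof -
    have "cycle_on (V - {v, w}) (add_mset {p, q} (P2 + M))" using that by simp
    then have "cycle_on (insert v (V - {v, w})) (add_mset {p, v} (add_mset {v, q} (P2 + M)))"
      by (rule cycle_on_subdivide) simp
    then have "cycle_on (insert v (V - {v, w})) (add_mset {v, q} (add_mset {p, v} (P2 + M)))"
      by (simp add: add_mset_commute)
    then have "cycle_on (insert w (insert v (V - {v, w})))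
        (add_mset {v, w} (add_mset {w, q} (add_mset {p, v} (P2 + M))))"
      by (rule cycle_on_subdivide) (use vw in simp)
    moreover have "insert w (insert v (V - {v, w})) = V" using vw by blast
    ultimately show ?thesis
      by (simp add: P1 P2 add_mset_commute insert_commute)
  qed
  ultimately show thesis using that by blast
qed

lemma perfect_matching_doubleton:
  assumes "perfect_matching {a, b} P" "a \<noteq> b"
  shows "P = {#{a, b}#}"
proof -
  have P: "multigraph {a, b} P" using assms by (simp add: perfect_matching_def)
  have "size P = 1"
    using handshake[OF P] assms by (simp add: perfect_matching_def)
  then obtain e where e: "P = {#e#}" using size_1_singleton_mset by blast
  then have "e \<subseteq> {a, b}" "card e = card {a, b}" using P assms by auto
  then show ?thesis using e by (simp add: card_subset_eq)
qed

text \<open>A vertex \<open>v\<close> may be joined to any vertex other than its partners in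
  \<open>P\<close> and \<open>Q\<close>, after which both matchings are contracted. The number
  \<open>j\<close> bounds the partners to avoid, so that \<open>2 * m + 4\<close> vertices leave at
  least \<open>2 * m + 3 - j\<close> choices. The product runs over the even numbers from 2 for
  \<open>j = 1\<close> and over the odd numbers from 1 for \<open>j = 2\<close>.\<close>

lemma card_completions_ge:
  assumes "perfect_matching V P" "perfect_matching V Q" "card V = 2 * Suc m"
    and "j = 2 \<or> (j = 1 \<and> P = Q)"
  shows "(\<Prod>i<m. 2 * i + 3 - j) \<le> card (completions V P Q)"
  using assms
proof (induction m arbitrary: V P Q)
  case 0
  then obtain a b where V: "V = {a, b}" "a \<noteq> b" by (auto simp: card_2_iff)
  have "P = {#{a, b}#}" "Q = {#{a, b}#}"
    using perfect_matching_doubleton[of a b] 0(1,2) V by auto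
  then have "{#{a, b}#} \<in> completions V P Q"
    using V cycle_on_digon by (simp add: completions_def)
  then have "card (completions V P Q) > 0"
    using finite_completions card_gt_0_iff by blast
  then show ?case by simp
next
  case (Suc m)
  have fin: "finite V" using Suc.prems(3) card_ge_0_finite by force
  obtain v where v: "v \<in> V" using Suc.prems(3) by fastforce
  obtain p where p: "\<And>w. {v, w} \<in># P \<longleftrightarrow> w = p"
    using perfect_matching_partner[OF Suc.prems(1) v] by blast
  obtain q where q: "\<And>w. {v, w} \<in># Q \<longleftrightarrow> w = q"
    using perfect_matching_partner[OF Suc.prems(2) v] by blast
  define X where "X = V - {v} - {p, q}"
  have "card {p, q} \<le> j"
  proof (cases "j = 2")
    case False
    then have "P = Q" "j = 1" using Suc.prems(4) by auto
    then have "p = q" using p q by blast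
    then show ?thesis using \<open>j = 1\<close> by simp
  qed (simp add: card_insert_if)
  then have X: "card X \<ge> 2 * m + 3 - j"
    using diff_card_le_card_Diff[of "{p, q}" "V - {v}"] Suc.prems(3) v
    unfolding X_def by (simp add: card_Diff_singleton)
  have "\<exists>P' Q'. perfect_matching (V - {v, w}) P' \<and> perfect_matching (V - {v, w}) Q' \<and>
      (j = 2 \<or> (j = 1 \<and> P' = Q')) \<and>
      (\<forall>M \<in> completions (V - {v, w}) P' Q'. add_mset {v, w} M \<in> completions V P Q)"
    if w: "w \<in> X" for w
  proof -
    have w': "w \<in> V" "v \<noteq> w" "{v, w} \<notin># P" "{v, w} \<notin># Q"
      using w p q by (auto simp: X_def)
    obtain P' where P': "perfect_matching (V - {v, w}) P'"
      "\<And>M. cycle_on (V - {v, w}) (P' + M) \<Longrightarrow> cycle_on V (P + add_mset {v, w} M)"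
      using perfect_matching_contract[OF Suc.prems(1) v w'(1,2,3)] by blast
    obtain Q' where Q': "perfect_matching (V - {v, w}) Q'"
      "\<And>M. cycle_on (V - {v, w}) (Q' + M) \<Longrightarrow> cycle_on V (Q + add_mset {v, w} M)"
      using perfect_matching_contract[OF Suc.prems(2) v w'(1,2,4)] by blast
    show ?thesis
    proof (cases "j = 2")
      case True
      then show ?thesis
        by (intro exI[of _ P'] exI[of _ Q']) (use P' Q' in \<open>simp add: completions_def\<close>)
    next
      case False
      \<comment> \<open>One contraction serves for both matchings, so that they stay equal.\<close>
      then show ?thesis
        by (intro exI[of _ P']) (use P' Suc.prems(4) in \<open>simp add: completions_def\<close>)
    qed
  qed
  then obtain P' Q' where PQ: "\<And>w. w \<in> X \<Longrightarrow> perfect_matching (V - {v, w}) (P' w)"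
      "\<And>w. w \<in> X \<Longrightarrow> perfect_matching (V - {v, w}) (Q' w)"
      "\<And>w. w \<in> X \<Longrightarrow> j = 2 \<or> (j = 1 \<and> P' w = Q' w)"
      "\<And>w M. w \<in> X \<Longrightarrow> M \<in> completions (V - {v, w}) (P' w) (Q' w) \<Longrightarrow>
        add_mset {v, w} M \<in> completions V P Q"
    by metis
  define T where "T = Sigma X (\<lambda>w. completions (V - {v, w}) (P' w) (Q' w))"
  define h where "h = (\<lambda>(w, M). add_mset {v, w} M)"
  \<comment> \<open>The added edge is the only one at \<open>v\<close>, so it reveals
    \<open>w\<close>.\<close>
  have "inj_on h T"
  proof (rule inj_onI)
    fix s t assume st: "s \<in> T" "t \<in> T" "h s = h t"
    obtain w M where s: "s = (w, M)" by fastforce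
    obtain x N where t: "t = (x, N)" by fastforce
    have eq: "add_mset {v, w} M = add_mset {v, x} N" using st s t by (simp add: h_def)
    have "multigraph (V - {v, x}) N"
      using st t by (auto simp: T_def completions_def dest!: cycle_on_multigraph)
    then have "{v, w} \<notin># N" by (auto simp: multigraph_def)
    moreover have "{v, w} \<in># add_mset {v, x} N" using eq by (metis union_single_eq_member)
    ultimately have "{v, w} = {v, x}" by simp
    then have "w = x" by (auto simp: doubleton_eq_iff)
    then show "s = t" using eq s t by simp
  qed
  moreover have "h ` T \<subseteq> completions V P Q"
    using PQ(4) by (auto simp: T_def h_def)
  ultimately have "card T \<le> card (completions V P Q)"
    by (rule card_inj_on_le) (rule finite_completions)
  moreover have "card T \<ge> (\<Prod>i<m. 2 * i + 3 - j) * (2 * m + 3 - j)"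
  proof -
    have "(\<Prod>i<m. 2 * i + 3 - j) \<le> card (completions (V - {v, w}) (P' w) (Q' w))" if "w \<in> X" for w
    proof (rule Suc.IH[OF PQ(1)[OF that] PQ(2)[OF that] _ PQ(3)[OF that]])
      show "card (V - {v, w}) = 2 * Suc m"
        using that v Suc.prems(3) by (subst card_Diff_subset) (auto simp: X_def card_insert_if)
    qed
    then have "(\<Sum>w\<in>X. \<Prod>i<m. 2 * i + 3 - j)
        \<le> (\<Sum>w\<in>X. card (completions (V - {v, w}) (P' w) (Q' w)))"
      by (rule sum_mono)
    also have "\<dots> = card T"
      using fin unfolding T_def by (subst card_SigmaI) (auto simp: X_def finite_completions)
    finally have "(\<Sum>w\<in>X. \<Prod>i<m. 2 * i + 3 - j) \<le> card T" .
    then have "card X * (\<Prod>i<m. 2 * i + 3 - j) \<le> card T" by simp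
    moreover have "(2 * m + 3 - j) * (\<Prod>i<m. 2 * i + 3 - j) \<le> card X * (\<Prod>i<m. 2 * i + 3 - j)"
      using X by (rule mult_le_mono1)
    ultimately show ?thesis unfolding mult.commute[of "2 * m + 3 - j"] by (rule order_trans[rotated])
  qed
  ultimately show ?case by simp
qed

section \<open>Splittings\<close>

definition splittings ::
  "'a set \<Rightarrow> 'a set multiset \<Rightarrow> 'a set multiset \<Rightarrow> ('a set multiset \<times> 'a set multiset) set" where
  "splittings V A B = {(M, N). cycle_on V (A + M) \<and> cycle_on V (B + N) \<and> cycle_on V (M + N)}"

text \<open>For a centre of degree 2 this makes its two neighbours distinct and keeps them outside
  \<open>U\<close>. Joining them when the centre is removed therefore gives a proper edge that
  touches no other centre.\<close>

definition independent_centres :: "'a set multiset \<Rightarrow> 'a set \<Rightarrow> bool" where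
  "independent_centres G U \<longleftrightarrow> (\<forall>e\<in>#G. \<forall>u\<in>e \<inter> U. count G e = 1 \<and> e \<inter> U = {u})"

text \<open>The sets \<open>S\<close> and \<open>T\<close> hold the centres whose two edges lie both
  in \<open>A\<close> or both in \<open>B\<close>; at all other vertices the colours alternate. The
  degrees add up to 2 everywhere.\<close>

definition edge_colouring ::
  "'a set \<Rightarrow> 'a set multiset \<Rightarrow> 'a set multiset \<Rightarrow> 'a set \<Rightarrow> 'a set \<Rightarrow> bool" where
  "edge_colouring V A B S T \<longleftrightarrow>
     multigraph V (A + B) \<and> S \<subseteq> V \<and> T \<subseteq> V \<and> S \<inter> T = {} \<and>
     (\<forall>v\<in>V. vertex_degree A v = (if v \<in> S then 2 else if v \<in> T then 0 else 1)) \<and>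
     (\<forall>v\<in>V. vertex_degree B v = (if v \<in> T then 2 else if v \<in> S then 0 else 1)) \<and>
     independent_centres (A + B) (S \<union> T)"

lemma edge_colouring_swap: "edge_colouring V A B S T \<Longrightarrow> edge_colouring V B A T S"
  unfolding edge_colouring_def by (auto simp: add.commute Un_commute)

lemma finite_splittings: "finite (splittings V A B)"
proof -
  let ?h = "\<lambda>(M, N). (A + M, B + N)"
  have "?h ` splittings V A B \<subseteq> {C. cycle_on V C} \<times> {C. cycle_on V C}"
    by (auto simp: splittings_def)
  then have "finite (?h ` splittings V A B)"
    using finite_cycles finite_subset by blast
  then show ?thesis by (rule finite_imageD) (auto simp: inj_on_def)
qed

lemma card_splittings_swap: "card (splittings V B A) = card (splittings V A B)"
proof -
  have "splittings V B A = prod.swap ` splittings V A B"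
    by (auto simp: splittings_def add.commute image_iff)
  then show ?thesis by (simp add: card_image)
qed

lemma splitting_right_degree:
  assumes col: "edge_colouring V A B S T" and MN: "(M, N) \<in> splittings V A B" and v: "v \<in> V"
  shows "vertex_degree N v = (if v \<in> T then 0 else if v \<in> S then 2 else 1)"
proof -
  have "cycle_on V (B + N)" using MN by (simp add: splittings_def)
  then have "vertex_degree (B + N) v = 2" using v by (rule cycle_on_degree)
  then show ?thesis using col v by (auto simp: edge_colouring_def split: if_splits)
qed

lemma splitting_left_degree:
  assumes col: "edge_colouring V A B S T" and MN: "(M, N) \<in> splittings V A B" and v: "v \<in> V"
  shows "vertex_degree M v = (if v \<in> S then 0 else if v \<in> T then 2 else 1)"
proof -
  have "cycle_on V (A + M)" using MN by (simp add: splittings_def)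
  then have "vertex_degree (A + M) v = 2" using v by (rule cycle_on_degree)
  then show ?thesis using col v by (auto simp: edge_colouring_def split: if_splits)
qed

text \<open>In \<open>N\<close> the \<open>2 * m\<close> vertices outside the centres have degree 1,
  those in \<open>S\<close> degree 2 and those in \<open>T\<close> degree 0, so the handshake
  formula gives \<open>m + card S\<close> edges. They are distinct because a double edge would be
  all of \<open>M + N\<close>.\<close>

lemma card_splitting_right:
  assumes col: "edge_colouring V A B S T" and MN: "(M, N) \<in> splittings V A B"
    and card: "card V = 2 * m + card S + card T" and m: "m \<ge> 1"
  shows "card (set_mset N) = m + card S"
proof -
  have cyc: "cycle_on V (B + N)" "cycle_on V (M + N)"
    using MN by (auto simp: splittings_def)
  have fin: "finite V" and ST: "S \<subseteq> V" "T \<subseteq> V"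
    using col by (auto simp: edge_colouring_def multigraph_finite)
  have "count N e = 1" if e: "e \<in># N" for e
  proof (rule ccontr)
    assume "count N e \<noteq> 1"
    then have two: "count N e \<ge> 2" using e
      by (metis One_nat_def Suc_leI count_greater_zero_iff le_neq_implies_less one_add_one plus_1_eq_Suc)
    then have V: "V = e" using cycle_on_double_edge[OF cyc(2), of e] by simp
    have "card e = 2"
      using e cycle_on_multigraph[OF cyc(1)] by (auto simp: multigraph_def)
    then obtain u where "u \<in> e" by fastforce
    \<comment> \<open>As \<open>m \<ge> 1\<close>, two vertices leave no room for a centre. The
      degrees in \<open>N\<close> are then 1, which rules out the double edge.\<close>
    have "card S = 0" "card T = 0" using card V m \<open>card e = 2\<close> by auto
    then have "S = {}" "T = {}" using fin ST by (auto dest: finite_subset)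
    then have "vertex_degree N u = 1"
      using splitting_right_degree[OF col MN, of u] V \<open>u \<in> e\<close> by simp
    then show False using count_le_vertex_degree[OF \<open>u \<in> e\<close>, of N] two by simp
  qed
  then have "card (set_mset N) = size N"
    by (simp add: size_multiset_overloaded_eq)
  moreover have "2 * size N = (\<Sum>v\<in>V. vertex_degree N v)"
    using handshake[of V N] cycle_on_multigraph[OF cyc(1)] by simp
  \<comment> \<open>The contribution of \<open>T\<close> is added on the left instead of subtracted
    on the right, since the degrees are natural numbers.\<close>
  moreover have "(\<Sum>v\<in>V. vertex_degree N v + (if v \<in> T then 1 else 0))
      = (\<Sum>v\<in>V. 1 + (if v \<in> S then 1 else 0))"
    using col by (intro sum.cong) (auto simp: splitting_right_degree[OF col MN] edge_colouring_def)
  then have "(\<Sum>v\<in>V. vertex_degree N v) + card T = card V + card S"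
    using fin ST unfolding sum.distrib by (simp add: sum.If_cases Int_absorb1)
  ultimately show ?thesis using card by simp
qed

section \<open>Inserting a centre into an edge\<close>

definition spokes :: "'a \<Rightarrow> 'a set \<Rightarrow> 'a set multiset" where
  "spokes v e = image_mset (\<lambda>x. {v, x}) (mset_set e)"

lemma spokes_doubleton: "x \<noteq> y \<Longrightarrow> spokes v {x, y} = {#{v, x}, {v, y}#}"
  by (simp add: spokes_def)

lemma cycle_on_subdivide_spokes:
  assumes C: "cycle_on V C" and e: "e \<in># C" and v: "v \<notin> V"
  shows "cycle_on (insert v V) (C - {#e#} + spokes v e)"
proof -
  have "card e = 2" using cycle_on_multigraph[OF C] e by (auto simp: multigraph_def)
  then obtain x y where xy: "e = {x, y}" "x \<noteq> y" by (auto simp: card_2_iff)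
  have "cycle_on V (add_mset {x, y} (C - {#e#}))" using C e xy by simp
  from cycle_on_subdivide[OF this v] show ?thesis
    using xy by (simp add: spokes_doubleton insert_commute)
qed

text \<open>No edge of \<open>N\<close> contains \<open>v\<close>. Hence the edges at
  \<open>v\<close> are exactly the spokes, their other ends form \<open>e\<close>, and the edges
  that avoid \<open>v\<close> are those of \<open>N\<close> without \<open>e\<close>.\<close>

lemma spokes_inj:
  assumes "multigraph V N" "e \<in># N" "multigraph V N'" "e' \<in># N'" "v \<notin> V"
    and eq: "N - {#e#} + spokes v e = N' - {#e'#} + spokes v e'"
  shows "N = N' \<and> e = e'"
proof -
  have *: "filter_mset (\<lambda>f. v \<in> f) (K - {#f#} + spokes v f) = spokes v f"
      "filter_mset (\<lambda>f. v \<notin> f) (K - {#f#} + spokes v f) = K - {#f#}"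
      "\<Union> (set_mset (spokes v f)) - {v} = f"
    if K: "multigraph V K" "f \<in># K" for K f
  proof -
    have "finite f" "v \<notin> f" "f \<noteq> {}"
      using that assms(5) by (auto simp: multigraph_def card_2_iff)
    have 1: "v \<notin> g" if "g \<in># K - {#f#}" for g
      using that K assms(5) by (auto simp: multigraph_def dest: in_diffD)
    have 2: "v \<in> g" if "g \<in># spokes v f" for g
      using that by (auto simp: spokes_def)
    have 3: "filter_mset P L = {#}" if "\<And>g. g \<in># L \<Longrightarrow> \<not> P g" for P and L :: "'a set multiset"
      using that by (simp add: filter_mset_eq_mempty_iff)
    have 4: "filter_mset P L = L" if "\<And>g. g \<in># L \<Longrightarrow> P g" for P and L :: "'a set multiset"
      using that filter_mset_cong[of L L P "\<lambda>_. True"] by simp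
    show "filter_mset (\<lambda>f. v \<in> f) (K - {#f#} + spokes v f) = spokes v f"
      using 3[of "K - {#f#}" "\<lambda>g. v \<in> g"] 4[of "spokes v f" "\<lambda>g. v \<in> g"] 1 2
      by (simp del: filter_diff_mset)
    show "filter_mset (\<lambda>f. v \<notin> f) (K - {#f#} + spokes v f) = K - {#f#}"
      using 4[of "K - {#f#}" "\<lambda>g. v \<notin> g"] 3[of "spokes v f" "\<lambda>g. v \<notin> g"] 1 2
      by (simp del: filter_diff_mset)
    show "\<Union> (set_mset (spokes v f)) - {v} = f"
      using \<open>finite f\<close> \<open>v \<notin> f\<close> by (auto simp: spokes_def)
  qed
  have "spokes v e = spokes v e'"
    using *(1)[OF assms(1,2)] *(1)[OF assms(3,4)] eq by simp
  then have "e = e'"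
    using *(3)[OF assms(1,2)] *(3)[OF assms(3,4)] by metis
  moreover have "N - {#e#} = N' - {#e'#}"
    using *(2)[OF assms(1,2)] *(2)[OF assms(3,4)] eq by simp
  ultimately show ?thesis using assms(2,4) by (metis insert_DiffM)
qed

text \<open>The path \<open>a\<close>, \<open>v\<close>, \<open>b\<close> shrinks to the edge
  \<open>{a, b}\<close>, which keeps the degrees of \<open>a\<close> and \<open>b\<close> in
  \<open>A\<close>. Independence gives \<open>a \<noteq> b\<close> and shows that neither is a
  centre, so no edge at another centre changes.\<close>

lemma edge_colouring_contract:
  assumes col: "edge_colouring V A B S T" and v: "v \<in> S"
  obtains a b A0 where "A = add_mset {a, v} (add_mset {v, b} A0)"
    "edge_colouring (V - {v}) (add_mset {a, b} A0) B (S - {v}) T"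
proof -
  have G: "multigraph V A" "multigraph V B" and ST: "S \<subseteq> V" "T \<subseteq> V" "S \<inter> T = {}" and
    dA: "\<And>u. u \<in> V \<Longrightarrow> vertex_degree A u = (if u \<in> S then 2 else if u \<in> T then 0 else 1)" and
    dB: "\<And>u. u \<in> V \<Longrightarrow> vertex_degree B u = (if u \<in> T then 2 else if u \<in> S then 0 else 1)" and
    ind: "\<And>e u. e \<in># A + B \<Longrightarrow> u \<in> e \<Longrightarrow> u \<in> S \<union> T \<Longrightarrow> count (A + B) e = 1 \<and> e \<inter> (S \<union> T) = {u}"
    using col unfolding edge_colouring_def independent_centres_def by auto
  have vV: "v \<in> V" using v ST by blast
  obtain a A1 where A1: "A = add_mset {v, a} A1" "a \<noteq> v" "a \<in> V" "vertex_degree A1 v = 1"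
    using obtain_edge_at[OF G(1), of v 1] dA[OF vV] v by auto
  obtain b A0 where A0: "A1 = add_mset {v, b} A0" "b \<noteq> v" "b \<in> V" "vertex_degree A0 v = 0"
    using obtain_edge_at[of V A1 v 0] A1 G(1) by auto
  have ab: "a \<noteq> b" "a \<notin> S \<union> T" "b \<notin> S \<union> T"
    using ind[of "{v, a}" v] ind[of "{v, b}" v] A1 A0 v by auto
  have eq: "A = add_mset {a, v} (add_mset {v, b} A0)"
    using A1 A0 by (simp add: insert_commute)
  have "vertex_degree B v = 0" using dB[OF vV] v ST by auto
  then have "multigraph (V - {v}) (A0 + B)"
    using multigraph_remove_vertices[of V "A0 + B" "{v}"] G A0 A1 by auto
  moreover have "independent_centres (add_mset {a, b} A0 + B) (S - {v} \<union> T)"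
    unfolding independent_centres_def
  proof clarify
    fix e u assume e: "e \<in># add_mset {a, b} A0 + B" and u: "u \<in> e" "u \<in> S - {v} \<union> T"
    have ne: "e \<noteq> {a, b}" using u ab by auto
    then have e': "e \<in># A0 + B" using e by auto
    then have "e \<in># A + B" unfolding eq by auto
    then have *: "count (A + B) e = 1" "e \<inter> (S \<union> T) = {u}"
      using ind[of e u] u by blast+
    moreover have "v \<notin> e"
      using e' A0(4) \<open>vertex_degree B v = 0\<close> by (auto simp: vertex_degree_eq_0_iff)
    ultimately have "e \<noteq> {a, v}" "e \<noteq> {v, b}" "e \<inter> (S - {v} \<union> T) = {u}"
      using u by auto
    then show "count (add_mset {a, b} A0 + B) e = 1 \<and> e \<inter> (S - {v} \<union> T) = {u}"
      using ne *(1) unfolding eq by simp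
  qed
  moreover have "vertex_degree (add_mset {a, b} A0) u
      = (if u \<in> S - {v} then 2 else if u \<in> T then 0 else 1)"
    "vertex_degree B u = (if u \<in> T then 2 else if u \<in> S - {v} then 0 else 1)"
    if "u \<in> V - {v}" for u
    using dA[of u] dB[of u] that ab unfolding eq by (auto split: if_splits)
  moreover have "{a, b} \<subseteq> V - {v}" "card {a, b} = 2"
    using A1 A0 ab by auto
  ultimately have "edge_colouring (V - {v}) (add_mset {a, b} A0) B (S - {v}) T"
    unfolding edge_colouring_def using ST v by auto
  then show thesis using that eq by blast
qed

text \<open>A splitting of the contracted colouring keeps its \<open>M\<close>: in
  \<open>A + M\<close> the vertex \<open>v\<close> goes back into the edge \<open>{a, b}\<close>. In
  \<open>N\<close> it may subdivide any edge, which subdivides \<open>B + N\<close> and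
  \<open>M + N\<close> at the same time. The factor is the number of edges of
  \<open>N\<close>.\<close>

lemma card_splittings_step:
  assumes col: "edge_colouring V A B S T" and v: "v \<in> S"
    and card: "card V = 2 * m + card S + card T" and m: "m \<ge> 1"
  obtains A' where "edge_colouring (V - {v}) A' B (S - {v}) T"
    "(m + card (S - {v})) * card (splittings (V - {v}) A' B) \<le> card (splittings V A B)"
proof -
  obtain a b A0 where A: "A = add_mset {a, v} (add_mset {v, b} A0)" and
    col': "edge_colouring (V - {v}) (add_mset {a, b} A0) B (S - {v}) T"
    using edge_colouring_contract[OF col v] .
  let ?A = "add_mset {a, b} A0" and ?V = "V - {v}"
  have fin: "finite V" "finite S" and "v \<in> V"
    using col v by (auto simp: edge_colouring_def multigraph_finite dest: finite_subset)
  then have V: "insert v ?V = V" "v \<notin> ?V" by auto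
  have card': "card ?V = 2 * m + card (S - {v}) + card T"
    using card card.remove[OF fin(1) \<open>v \<in> V\<close>] card.remove[OF fin(2) v] by simp
  define X where "X = Sigma (splittings ?V ?A B) (\<lambda>(M, N). set_mset N)"
  define h where "h = (\<lambda>((M, N), e). (M, N - {#e#} + spokes v e)
      :: 'a set multiset \<times> 'a set multiset)"
  have "inj_on h X"
  proof (rule inj_onI)
    fix s t assume st: "s \<in> X" "t \<in> X" "h s = h t"
    obtain M N e where s: "s = ((M, N), e)" by (metis surj_pair)
    obtain M' N' e' where t: "t = ((M', N'), e')" by (metis surj_pair)
    have "multigraph ?V N" "e \<in># N" "multigraph ?V N'" "e' \<in># N'"
      using st s t by (auto simp: X_def splittings_def dest!: cycle_on_multigraph)
    moreover have "M = M'" "N - {#e#} + spokes v e = N' - {#e'#} + spokes v e'"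
      using st s t by (auto simp: h_def)
    ultimately show "s = t" using spokes_inj[of ?V N e N' e' v] V(2) s t by auto
  qed
  moreover have "h ` X \<subseteq> splittings V A B"
  proof (rule subrelI)
    fix M N assume "(M, N) \<in> h ` X"
    then obtain N' e where N: "N = N' - {#e#} + spokes v e" "e \<in># N'"
      and MN: "(M, N') \<in> splittings ?V ?A B"
      by (auto simp: h_def X_def)
    have cyc: "cycle_on ?V (add_mset {a, b} (A0 + M))" "cycle_on ?V (B + N')" "cycle_on ?V (M + N')"
      using MN by (auto simp: splittings_def)
    have "cycle_on V (A + M)"
      using cycle_on_subdivide[OF cyc(1) V(2)] V(1) A by simp
    moreover have "cycle_on V (B + N)" "cycle_on V (M + N)"
      using cycle_on_subdivide_spokes[OF cyc(2) _ V(2), of e]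
        cycle_on_subdivide_spokes[OF cyc(3) _ V(2), of e] N V(1)
      by (simp_all add: add.assoc)
    ultimately show "(M, N) \<in> splittings V A B" by (simp add: splittings_def)
  qed
  ultimately have "card X \<le> card (splittings V A B)"
    by (rule card_inj_on_le) (rule finite_splittings)
  moreover have "card X = (m + card (S - {v})) * card (splittings ?V ?A B)"
  proof -
    have "card X = (\<Sum>(M, N)\<in>splittings ?V ?A B. card (set_mset N))"
      unfolding X_def by (subst card_SigmaI) (auto simp: finite_splittings case_prod_beta)
    also have "\<dots> = (\<Sum>(M, N)\<in>splittings ?V ?A B. m + card (S - {v}))"
      using card_splitting_right[OF col' _ card' m] by (intro sum.cong) auto
    finally show ?thesis by (simp add: case_prod_beta)
  qed
  ultimately show thesis using that[OF col'] by simp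
qed

section \<open>Lower bounds for the number of splittings\<close>

lemma prod_consecutive_pairs: "(\<Prod>i<m. 2 * i + 2) * (\<Prod>i<m. 2 * i + 1) = (fact (2 * m) :: nat)"
  by (induction m) (simp_all add: algebra_simps)

text \<open>First \<open>M\<close> is chosen to complete \<open>A\<close>; it is again a perfect
  matching, so \<open>N\<close> can be chosen to complete \<open>B\<close> and \<open>M\<close>
  simultaneously. The two bounds are the even and the odd factors of
  \<open>fact (2 * m)\<close>.\<close>

lemma card_splittings_perfect_matchings:
  assumes A: "perfect_matching V A" and B: "perfect_matching V B" and card: "card V = 2 * Suc m"
  shows "fact (2 * m) \<le> card (splittings V A B)"
proof -
  define X where "X = Sigma (completions V A A) (\<lambda>M. completions V B M)"
  have "X \<subseteq> splittings V A B"
    by (auto simp: X_def completions_def splittings_def)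
  then have "card X \<le> card (splittings V A B)"
    by (intro card_mono finite_splittings)
  moreover have "card X \<ge> (\<Prod>i<m. 2 * i + 2) * (\<Prod>i<m. 2 * i + 1)"
  proof -
    have "(\<Prod>i<m. 2 * i + 1) \<le> card (completions V B M)" if "M \<in> completions V A A" for M
    proof -
      have cyc: "cycle_on V (A + M)" using that by (simp add: completions_def)
      have "vertex_degree M u = 1" if "u \<in> V" for u
        using cycle_on_degree[OF cyc that] A that by (simp add: perfect_matching_def)
      then have "perfect_matching V M"
        using cycle_on_multigraph[OF cyc] by (simp add: perfect_matching_def)
      then show ?thesis using card_completions_ge[OF B _ card, of M 2] by simp
    qed
    then have "(\<Sum>M\<in>completions V A A. \<Prod>i<m. 2 * i + 1)
        \<le> (\<Sum>M\<in>completions V A A. card (completions V B M))"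
      by (rule sum_mono)
    also have "\<dots> = card X"
      unfolding X_def by (subst card_SigmaI) (auto simp: finite_completions)
    finally have "card (completions V A A) * (\<Prod>i<m. 2 * i + 1) \<le> card X" by simp
    moreover have "(\<Prod>i<m. 2 * i + 2) \<le> card (completions V A A)"
      using card_completions_ge[OF A A card, of 1] by simp
    then have "(\<Prod>i<m. 2 * i + 2) * (\<Prod>i<m. 2 * i + 1)
        \<le> card (completions V A A) * (\<Prod>i<m. 2 * i + 1)"
      by (rule mult_le_mono1)
    ultimately show ?thesis by (rule order_trans[rotated])
  qed
  ultimately show ?thesis unfolding prod_consecutive_pairs by simp
qed

text \<open>The centres are removed one at a time, down to two perfect matchings. Each removal from
  a class contributes \<open>Suc m\<close> plus the number of centres left in that class, and these
  factors form the rising factorials.\<close>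

lemma card_splittings_ge:
  assumes "edge_colouring V A B S T" and "card V = 2 * Suc m + card S + card T"
  shows "fact (2 * m) * pochhammer (Suc m) (card S) * pochhammer (Suc m) (card T)
    \<le> card (splittings V A B)"
  using assms
proof (induction "card S + card T" arbitrary: V A B S T)
  case 0
  then have "finite S" "finite T"
    by (auto simp: edge_colouring_def dest: multigraph_finite finite_subset)
  then have "S = {}" "T = {}" using 0 by auto
  then have "perfect_matching V A" "perfect_matching V B"
    using 0 by (auto simp: edge_colouring_def perfect_matching_def)
  then show ?case
    using card_splittings_perfect_matchings[of V A B m] 0 \<open>S = {}\<close> \<open>T = {}\<close> by simp
next
  case (Suc k)
  \<comment> \<open>The claim is kept general in the colouring so that it also applies with the two
    colours exchanged, when only \<open>T\<close> has centres.\<close>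
  have left: "fact (2 * m) * pochhammer (Suc m) (card S) * pochhammer (Suc m) (card T)
      \<le> card (splittings V A B)"
    if col: "edge_colouring V A B S T" and card: "card V = 2 * Suc m + card S + card T"
      and k: "Suc k = card S + card T" and S: "S \<noteq> {}" for A B S T
  proof -
    obtain v where v: "v \<in> S" using S by blast
    obtain A' where col': "edge_colouring (V - {v}) A' B (S - {v}) T" and
      le: "(Suc m + card (S - {v})) * card (splittings (V - {v}) A' B) \<le> card (splittings V A B)"
      using card_splittings_step[OF col v card] by auto
    have "finite S" "v \<in> V"
      using col v by (auto simp: edge_colouring_def dest: multigraph_finite finite_subset)
    then have S': "card S = Suc (card (S - {v}))" "card (V - {v}) = card V - 1"
      using card.remove[of S v] v by auto
    have "fact (2 * m) * pochhammer (Suc m) (card (S - {v})) * pochhammer (Suc m) (card T)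
      \<le> card (splittings (V - {v}) A' B)"
      using Suc.hyps(1)[OF _ col'] k card S' by simp
    then have "(Suc m + card (S - {v})) *
        (fact (2 * m) * pochhammer (Suc m) (card (S - {v})) * pochhammer (Suc m) (card T))
      \<le> card (splittings V A B)"
      using le by (meson le_trans mult_le_mono2)
    then show ?thesis unfolding S'(1) by (simp add: pochhammer_Suc algebra_simps)
  qed
  show ?case
  proof (cases "S = {}")
    case False
    then show ?thesis using left Suc.prems Suc.hyps(2) by blast
  next
    case True
    then have "T \<noteq> {}" using Suc.hyps(2) by auto
    then have "fact (2 * m) * pochhammer (Suc m) (card T) * pochhammer (Suc m) (card S)
      \<le> card (splittings V B A)"
      using left[OF edge_colouring_swap[OF Suc.prems(1)]] Suc.prems(2) Suc.hyps(2) by simp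
    then show ?thesis by (simp add: card_splittings_swap mult.assoc mult.commute mult.left_commute)
  qed
qed

section \<open>Colouring a 2-regular graph\<close>

lemma subset_mset_add_mset_right: "A \<subseteq># B \<Longrightarrow> A \<subseteq># add_mset x B"
  by (simp add: subseteq_mset_def le_SucI)

text \<open>
  Every 2-regular multigraph arises from the empty one by adding a digon, adding a triangle, and
  replacing an edge by a path of length 3. Only a triangle needs a vertex whose two edges have the
  same colour; its colour is free.
\<close>

lemma two_regular_centres:
  assumes "two_regular V G"
  obtains U m where "U \<subseteq> V" "card V = 2 * m + card U" "V \<noteq> {} \<Longrightarrow> m \<ge> 1"
    "independent_centres G U"
    "\<And>S. S \<subseteq> U \<Longrightarrow> \<exists>A. A \<subseteq># G \<and>
       (\<forall>v\<in>V. vertex_degree A v = (if v \<in> S then 2 else if v \<in> U then 0 else 1))"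
proof -
  have "\<exists>U m. U \<subseteq> V \<and> card V = 2 * m + card U \<and> (V \<noteq> {} \<longrightarrow> m \<ge> 1) \<and> independent_centres G U \<and>
    (\<forall>S. S \<subseteq> U \<longrightarrow> (\<exists>A. A \<subseteq># G \<and>
       (\<forall>v\<in>V. vertex_degree A v = (if v \<in> S then 2 else if v \<in> U then 0 else 1))))"
    (is "\<exists>U m. ?P V G U m")
    using assms
  proof (induction "card V" arbitrary: V G rule: less_induct)
    case less
    have GV: "multigraph V G" and dG: "\<And>v. v \<in> V \<Longrightarrow> vertex_degree G v = 2"
      using less.prems by (auto simp: two_regular_def)
    have fin: "finite V" by (rule multigraph_finite[OF GV])
    show ?case
    proof (cases "V = {}")
      case True
      then have "G = {#}" using GV by (cases G) auto
      then have "?P V G {} 0" using True by (auto simp: independent_centres_def)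
      then show ?thesis by blast
    next
      case False
      then obtain v where v: "v \<in> V" by blast
      obtain w G1 where G1: "G = add_mset {v, w} G1" "w \<noteq> v" "w \<in> V" "vertex_degree G1 v = 1"
        using obtain_edge_at[OF GV, of v 1] dG[OF v] by auto
      obtain a G2 where G2: "G1 = add_mset {v, a} G2" "a \<noteq> v" "a \<in> V" "vertex_degree G2 v = 0"
        using obtain_edge_at[of V G1 v 0] GV G1 by auto
      have G2V: "multigraph V G2" using GV G1 G2 by simp
      show ?thesis
      proof (cases "a = w")
        case True
        \<comment> \<open>The digon on \<open>v\<close> and \<open>w\<close> is a cycle of its own;
          its two edges get different colours and no centre is added.\<close>
        let ?W = "V - {v, w}"
        have w0: "vertex_degree G2 w = 0" using dG[OF G1(3)] G1 G2 True by simp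
        have GW: "multigraph ?W G2"
          using multigraph_remove_vertices[OF G2V, of "{v, w}"] G2(4) w0 by auto
        have "vertex_degree G2 u = 2" if "u \<in> ?W" for u
          using dG[of u] that G1(1) G2(1) True by simp
        then have "two_regular ?W G2" using GW by (simp add: two_regular_def)
        moreover have card: "card V = card ?W + 2" "card ?W < card V"
          using card_Diff_subset[of "{v, w}" V] card_mono[of V "{v, w}"] v G1 fin by auto
        ultimately have "\<exists>U m. ?P ?W G2 U m" by (intro less.hyps)
        then obtain U m where U: "?P ?W G2 U m" by (elim exE) (rule that)
        have UG: "u \<noteq> v" "u \<noteq> w" if "u \<in> U" for u using U that by auto
        have "independent_centres G U"
          using U UG unfolding independent_centres_def G1(1) G2(1) True by auto
        moreover have "\<exists>A. A \<subseteq># G \<and>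
            (\<forall>u\<in>V. vertex_degree A u = (if u \<in> S then 2 else if u \<in> U then 0 else 1))"
          if S: "S \<subseteq> U" for S
        proof -
          obtain A where A: "A \<subseteq># G2"
            "\<forall>u\<in>?W. vertex_degree A u = (if u \<in> S then 2 else if u \<in> U then 0 else 1)"
            using U S by blast
          have "vertex_degree A v = 0" "vertex_degree A w = 0"
            using vertex_degree_mono[OF A(1)] G2(4) w0 by (metis le_zero_eq)+
          moreover have "v \<notin> U" "w \<notin> U" using UG by auto
          ultimately show ?thesis
            using A S by (intro exI[of _ "add_mset {v, w} A"])
              (auto simp: G1(1) G2(1) True intro: subset_mset_add_mset_right)
        qed
        ultimately have "?P V G U (Suc m)" using U card by auto
        then show ?thesis by blast
      next
        case aw: False
        have "vertex_degree G2 w = Suc 0" using dG[OF G1(3)] G1 G2 aw by simp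
        then obtain b G3 where G3: "G2 = add_mset {w, b} G3" "b \<noteq> w" "b \<in> V" "vertex_degree G3 w = 0"
          using obtain_edge_at[OF G2V, of w 0] by auto
        have bv: "b \<noteq> v" using G2(4) G3(1) by auto
        have v0: "vertex_degree G3 v = 0" using G2(4) G3(1) bv G1(2) by simp
        have G3V: "multigraph V G3" using G2V G3 by simp
        have G: "G = add_mset {v, w} (add_mset {v, a} (add_mset {w, b} G3))"
          using G1 G2 G3 by simp
        have avoid: "v \<notin> e" "w \<notin> e" if "e \<in># G3" for e
          using that v0 G3(4) by (auto simp: vertex_degree_eq_0_iff)
        show ?thesis
        proof (cases "a = b")
          case True
          \<comment> \<open>The triangle on \<open>v\<close>, \<open>w\<close> and \<open>a\<close>
            is a cycle of its own, and \<open>v\<close> becomes its centre.\<close>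
          let ?W = "V - {v, w, a}"
          have a0: "vertex_degree G3 a = 0" using dG[OF G2(3)] G True aw G2(2) by simp
          have GW: "multigraph ?W G3"
            using multigraph_remove_vertices[OF G3V, of "{v, w, a}"] v0 G3(4) a0 by auto
          have "vertex_degree G3 u = 2" if "u \<in> ?W" for u
            using dG[of u] that G True by simp
          then have "two_regular ?W G3" using GW by (simp add: two_regular_def)
          moreover have card: "card V = card ?W + 3" "card ?W < card V"
            using card_Diff_subset[of "{v, w, a}" V] card_mono[of V "{v, w, a}"] v G1 G2 aw fin by auto
          ultimately have "\<exists>U m. ?P ?W G3 U m" by (intro less.hyps)
          then obtain U m where U: "?P ?W G3 U m" by (elim exE) (rule that)
          have UG: "u \<noteq> v" "u \<noteq> w" "u \<noteq> a" if "u \<in> U" for u using U that by auto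
          then have vU: "v \<notin> U" "w \<notin> U" "a \<notin> U" by blast+
          have "independent_centres G (insert v U)"
            unfolding independent_centres_def
          proof clarify
            fix e u assume e: "e \<in># G" "u \<in> e" "u \<in> insert v U"
            then consider "e = {v, w}" | "e = {v, a}" | "e = {w, b}" | "e \<in># G3"
              unfolding G by auto
            then show "count G e = 1 \<and> e \<inter> insert v U = {u}"
            proof cases
              case 4
              then have "u \<in> U" using e avoid by blast
              then have "count G3 e = 1 \<and> e \<inter> U = {u}"
                using U 4 e unfolding independent_centres_def by blast
              then show ?thesis using avoid[OF 4] unfolding G by auto
            qed (use e vU True aw avoid G1(2) G2(2) in
                \<open>auto simp: G doubleton_eq_iff count_eq_zero_iff\<close>)
          qed
          moreover have "\<exists>A. A \<subseteq># G \<and>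
              (\<forall>u\<in>V. vertex_degree A u = (if u \<in> S then 2 else if u \<in> insert v U then 0 else 1))"
            if S: "S \<subseteq> insert v U" for S
          proof -
            have "S - {v} \<subseteq> U" using S by blast
            then obtain A where A: "A \<subseteq># G3"
              "\<And>u. u \<in> ?W \<Longrightarrow> vertex_degree A u = (if u \<in> S - {v} then 2 else if u \<in> U then 0 else 1)"
              using U by meson
            have A0: "vertex_degree A v = 0" "vertex_degree A w = 0" "vertex_degree A a = 0"
              using vertex_degree_mono[OF A(1)] v0 G3(4) a0 by (metis le_zero_eq)+
            have nS: "w \<notin> S" "a \<notin> S" using S vU G1(2) G2(2) by auto
            \<comment> \<open>Both edges at \<open>v\<close> take the colour chosen for it, and the
              third edge of the triangle takes the other colour.\<close>
            show ?thesis
            proof (cases "v \<in> S")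
              case vS: True
              have "vertex_degree (add_mset {v, w} (add_mset {v, a} A)) u
                  = (if u \<in> S then 2 else if u \<in> insert v U then 0 else 1)" if "u \<in> V" for u
                using A(2)[of u] A0 vS nS vU that aw G1(2) G2(2) by (cases "u = v") auto
              then show ?thesis using A(1)
                by (intro exI[of _ "add_mset {v, w} (add_mset {v, a} A)"])
                  (auto simp: G intro: subset_mset_add_mset_right)
            next
              case vS: False
              have "vertex_degree (add_mset {w, b} A) u
                  = (if u \<in> S then 2 else if u \<in> insert v U then 0 else 1)" if "u \<in> V" for u
                using A(2)[of u] A0 vS nS vU that aw True G1(2) G2(2) by (cases "u = v") auto
              then show ?thesis using A(1)
                by (intro exI[of _ "add_mset {w, b} A"])
                  (auto simp: G intro: subset_mset_add_mset_right)
            qed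
          qed
          moreover have "U \<subseteq> V" using U by auto
          then have "insert v U \<subseteq> V" "card (insert v U) = Suc (card U)"
            using v vU finite_subset[OF _ fin, of U] by auto
          then have "insert v U \<subseteq> V" "card V = 2 * Suc m + card (insert v U)"
            using U card by auto
          ultimately have "?P V G (insert v U) (Suc m)" by simp
          then show ?thesis by blast
        next
          case ab: False
          \<comment> \<open>The path \<open>a\<close>, \<open>v\<close>, \<open>w\<close>,
            \<open>b\<close> shrinks to the edge \<open>{a, b}\<close>. This removes two vertices
            and keeps the set of centres.\<close>
          let ?W = "V - {v, w}" and ?H = "add_mset {a, b} G3"
          have GW: "multigraph ?W ?H"
            using multigraph_remove_vertices[OF G3V, of "{v, w}"] v0 G3 G2 ab aw bv by auto
          have "vertex_degree ?H u = 2" if "u \<in> ?W" for u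
            using dG[of u] that G ab by (auto split: if_splits)
          then have "two_regular ?W ?H" using GW by (simp add: two_regular_def)
          moreover have card: "card V = card ?W + 2" "card ?W < card V"
            using card_Diff_subset[of "{v, w}" V] card_mono[of V "{v, w}"] v G1 fin by auto
          ultimately have "\<exists>U m. ?P ?W ?H U m" by (intro less.hyps)
          then obtain U m where U: "?P ?W ?H U m" by (elim exE) (rule that)
          have vU: "v \<notin> U" "w \<notin> U" using U by auto
          have "independent_centres G U"
            unfolding independent_centres_def
          proof clarify
            fix e u assume e: "e \<in># G" "u \<in> e" "u \<in> U"
            then consider "e = {v, w}" | "e = {v, a}" | "e = {w, b}" | "e \<in># G3"
              unfolding G by auto
            then show "count G e = 1 \<and> e \<inter> U = {u}"
            proof cases
              case 4
              then have "count ?H e = 1 \<and> e \<inter> U = {u}"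
                using U e unfolding independent_centres_def by (metis IntI insert_iff set_mset_add_mset_insert)
              \<comment> \<open>This excludes the case that \<open>e\<close> is a copy of
                \<open>{a, b}\<close> in \<open>G3\<close>, since \<open>?H\<close> would then
                contain it twice.\<close>
              moreover have "count G3 e \<ge> 1" "count G3 e \<le> count ?H e" using 4 by simp_all
              ultimately have "count G3 e = 1" "e \<inter> U = {u}" by linarith+
              moreover have "e \<noteq> {v, w}" "e \<noteq> {v, a}" "e \<noteq> {w, b}" using avoid[OF 4] by auto
              ultimately show ?thesis unfolding G by simp
            qed (use e vU ab aw bv avoid G1(2) G2(2) G3(2) in
                \<open>auto simp: G doubleton_eq_iff count_eq_zero_iff\<close>)
          qed
          moreover have "\<exists>A. A \<subseteq># G \<and>
              (\<forall>u\<in>V. vertex_degree A u = (if u \<in> S then 2 else if u \<in> U then 0 else 1))"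
            if S: "S \<subseteq> U" for S
          proof -
            obtain A where A: "A \<subseteq># ?H"
              "\<And>u. u \<in> ?W \<Longrightarrow> vertex_degree A u = (if u \<in> S then 2 else if u \<in> U then 0 else 1)"
              using U S by meson
            have A0: "vertex_degree A v = 0" "vertex_degree A w = 0"
              using vertex_degree_outside[OF multigraph_subset_mset[OF GW A(1)]] by auto
            have nS: "v \<notin> S" "w \<notin> S" using S vU by auto
            \<comment> \<open>If \<open>{a, b}\<close> lies in \<open>A\<close>, it is replaced
              there by the two outer edges of the path; otherwise the middle edge joins
              \<open>A\<close>. Either way the colours alternate at \<open>v\<close> and
              \<open>w\<close> and are unchanged at \<open>a\<close> and \<open>b\<close>.\<close>
            show ?thesis
            proof (cases "{a, b} \<in># A")
              case in_A: True
              then obtain A' where A': "A = add_mset {a, b} A'" by (meson multi_member_split)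
              have "A' \<subseteq># G3" using A(1) A' by simp
              moreover have "vertex_degree (add_mset {v, a} (add_mset {w, b} A')) u
                  = (if u \<in> S then 2 else if u \<in> U then 0 else 1)" if "u \<in> V" for u
                using A(2)[of u] A0 nS vU that ab aw bv G1(2) G2(2) G3(2) unfolding A'
                by (auto split: if_splits)
              ultimately show ?thesis
                by (intro exI[of _ "add_mset {v, a} (add_mset {w, b} A')"])
                  (auto simp: G intro: subset_mset_add_mset_right)
            next
              case False
              then have "A \<subseteq># G3" using A(1)
                by (metis diff_single_trivial subset_eq_diff_conv add_mset_add_single)
              moreover have "vertex_degree (add_mset {v, w} A) u
                  = (if u \<in> S then 2 else if u \<in> U then 0 else 1)" if "u \<in> V" for u
                using A(2)[of u] A0 nS vU that G1(2) by (auto split: if_splits)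
              ultimately show ?thesis
                by (intro exI[of _ "add_mset {v, w} A"])
                  (auto simp: G intro: subset_mset_add_mset_right)
            qed
          qed
          moreover have "U \<subseteq> V" "card V = 2 * Suc m + card U" using U card by auto
          ultimately have "?P V G U (Suc m)" by simp
          then show ?thesis by blast
        qed
      qed
    qed
  qed
  then show thesis using that by blast
qed

section \<open>Counting compatible cycles\<close>

text \<open>This is Vandermonde's identity for rising factorials, as a sum over subsets. A new
  element either stays outside \<open>S\<close>, with factor \<open>y + card (U - S)\<close>, or
  joins it, with factor \<open>x + card S\<close>; the two factors add up to
  \<open>x + y + card U\<close>.\<close>

lemma sum_Pow_pochhammer:
  fixes x y :: nat
  assumes "finite U"
  shows "(\<Sum>S\<in>Pow U. pochhammer x (card S) * pochhammer y (card (U - S))) = pochhammer (x + y) (card U)"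
  using assms
proof (induction U)
  case empty
  then show ?case by simp
next
  case (insert u U)
  let ?f = "\<lambda>S. pochhammer x (card S) * pochhammer y (card (U - S))"
  let ?g = "\<lambda>S. pochhammer x (card S) * pochhammer y (card (insert u U - S))"
  have fin: "finite S" "u \<notin> S" "card S + card (U - S) = card U" if "S \<in> Pow U" for S
    using that insert card_Diff_subset[of S U] card_mono[of U S] by (auto dest: finite_subset)
  have "Pow U \<inter> insert u ` Pow U = {}" using insert by auto
  then have "(\<Sum>S\<in>Pow (insert u U). ?g S) = (\<Sum>S\<in>Pow U. ?g S) + (\<Sum>S\<in>insert u ` Pow U. ?g S)"
    using insert unfolding Pow_insert by (intro sum.union_disjoint) auto
  also have "(\<Sum>S\<in>insert u ` Pow U. ?g S) = (\<Sum>S\<in>Pow U. ?g (insert u S))"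
    using insert by (subst sum.reindex) (auto intro!: inj_onI)
  also have "(\<Sum>S\<in>Pow U. ?g S) + (\<Sum>S\<in>Pow U. ?g (insert u S)) = (\<Sum>S\<in>Pow U. ?g S + ?g (insert u S))"
    by (simp add: sum.distrib)
  also have "\<dots> = (\<Sum>S\<in>Pow U. ?f S * (x + y + card U))"
  proof (intro sum.cong refl)
    fix S assume S: "S \<in> Pow U"
    have "insert u U - S = insert u (U - S)" "insert u U - insert u S = U - S"
      using fin[OF S] insert by auto
    moreover have "card (insert u (U - S)) = Suc (card (U - S))" "card (insert u S) = Suc (card S)"
      using fin[OF S] insert by auto
    ultimately have "?g S + ?g (insert u S) = ?f S * (x + y + (card S + card (U - S)))"
      by (simp add: pochhammer_Suc algebra_simps)
    then show "?g S + ?g (insert u S) = ?f S * (x + y + card U)" using fin[OF S] by simp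
  qed
  also have "\<dots> = pochhammer (x + y) (card U) * (x + y + card U)"
    using insert.IH by (simp flip: sum_distrib_right)
  also have "\<dots> = pochhammer (x + y) (card (insert u U))"
    using insert by (simp add: pochhammer_Suc)
  finally show ?case .
qed

text \<open>Beyond \<open>fact (2 * m)\<close>, the left side has the factors from
  \<open>2 * m + 1\<close> to \<open>2 * m + k\<close>, and on the right each of them is larger by
  one.\<close>

lemma fact_mult_pochhammer_ge:
  "(fact (2 * m + k) :: nat) \<le> fact (2 * m) * pochhammer (2 * Suc m) k"
proof (induction k)
  case 0
  then show ?case by simp
next
  case (Suc k)
  then have "(2 * m + Suc k) * fact (2 * m + k)
      \<le> (2 * Suc m + k) * (fact (2 * m) * pochhammer (2 * Suc m) k)"
    by (intro mult_le_mono) auto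
  then show ?case by (simp add: pochhammer_Suc algebra_simps)
qed

section \<open>Recovering a splitting from its cycle\<close>

lemma cycle_on_simple:
  assumes "cycle_on V C" "card V \<ge> 3"
  shows "count C e \<le> 1"
proof (rule ccontr)
  assume "\<not> count C e \<le> 1"
  then have e: "count C e \<ge> 2" by simp
  then have "e \<in># C" by (metis count_eq_zero_iff not_numeral_le_zero)
  then have "card e = 2" using cycle_on_multigraph[OF assms(1)] by (auto simp: multigraph_def)
  then show False using cycle_on_double_edge[OF assms(1) e] assms(2) by simp
qed

lemma cycle_on_obtain_edges:
  assumes C: "cycle_on V C" and card: "card V \<ge> 3" and v: "v \<in> V"
  obtains e f where "filter_mset (\<lambda>g. v \<in> g) C = {#e, f#}" "e \<noteq> f"
proof -
  have "size (filter_mset (\<lambda>g. v \<in> g) C) = Suc (Suc 0)"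
    using cycle_on_degree[OF C v] by (simp add: vertex_degree_def)
  moreover from this obtain e D where D: "filter_mset (\<lambda>g. v \<in> g) C = add_mset e D"
    using size_eq_Suc_imp_eq_union by blast
  ultimately have "size D = 1" by simp
  then obtain f where "D = {#f#}" using size_1_singleton_mset by blast
  moreover have "count (filter_mset (\<lambda>g. v \<in> g) C) e \<le> 1"
    using cycle_on_simple[OF C card, of e] by simp
  ultimately show thesis using that[of e f] D by (auto split: if_splits)
qed

text \<open>
  Around a cycle, a splitting \<open>M + N\<close> changes sides exactly at the vertices outside \<open>U\<close>, so it is
  determined by the side of a single edge.
\<close>

lemma splitting_determined:
  assumes C: "cycle_on V (M + N)" and card: "card V \<ge> 3" and eq: "M + N = M' + N'"
    and deg: "\<And>v. v \<in> V \<Longrightarrow> vertex_degree M v = 1 \<longleftrightarrow> v \<notin> U"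
      "\<And>v. v \<in> V \<Longrightarrow> vertex_degree M' v = 1 \<longleftrightarrow> v \<notin> U"
    and e0: "e0 \<in># M + N" "e0 \<in># M \<longleftrightarrow> e0 \<in># M'"
  shows "M = M'"
proof -
  define agree where "agree = (\<lambda>e. e \<in># M \<longleftrightarrow> e \<in># M')"
  let ?C = "M + N"
  have simple: "count M e \<le> 1" "count M' e \<le> 1" for e
    using cycle_on_simple[OF C card, of e] arg_cong[OF eq, of "\<lambda>X. count X e"] by auto
  \<comment> \<open>The degree of \<open>v\<close> in \<open>K\<close> counts which of its two
    simple edges lie in \<open>K\<close>; they lie on different sides exactly if it is 1. The claim
    is stated for any \<open>K\<close> and \<open>L\<close> because it is used for both
    splittings.\<close>
  have sides: "(e \<in># K \<longleftrightarrow> f \<in># K) \<longleftrightarrow> vertex_degree K v \<noteq> 1"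
    if K: "?C = K + L" and ef: "filter_mset (\<lambda>g. v \<in> g) ?C = {#e, f#}" "e \<noteq> f" for K L v e f
  proof -
    let ?F = "filter_mset (\<lambda>g. v \<in> g) K"
    have split: "?F + filter_mset (\<lambda>g. v \<in> g) L = {#e, f#}" using ef K by simp
    then have F: "set_mset ?F \<subseteq> {e, f}"
      by (metis set_mset_add_mset_insert set_mset_empty set_mset_union sup_ge1)
    have "count ?F e \<le> 1" "count ?F f \<le> 1"
      using arg_cong[OF split, of "\<lambda>X. count X e"] arg_cong[OF split, of "\<lambda>X. count X f"] ef(2)
      by auto
    moreover have "vertex_degree K v = (\<Sum>g\<in>{e, f}. count ?F g)"
      unfolding vertex_degree_def size_multiset_overloaded_eq
      using F by (intro sum.mono_neutral_left) (auto simp: not_in_iff)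
    then have "vertex_degree K v = count ?F e + count ?F f" using ef(2) by simp
    moreover have "e \<in># {#e, f#}" "f \<in># {#e, f#}" by auto
    then have "v \<in> e" "v \<in> f" unfolding ef(1)[symmetric] by auto
    then have "e \<in># K \<longleftrightarrow> count ?F e > 0" "f \<in># K \<longleftrightarrow> count ?F f > 0"
      by auto
    ultimately show ?thesis by linarith
  qed
  \<comment> \<open>Both splittings change sides at the same vertices, so agreement on one edge at
    \<open>v\<close> passes to the other.\<close>
  have agree_at: "agree f" if "v \<in> V" "v \<in> e" "v \<in> f" "e \<in># ?C" "f \<in># ?C" "agree e" for v e f
  proof (cases "e = f")
    case False
    obtain g h where gh: "filter_mset (\<lambda>g. v \<in> g) ?C = {#g, h#}" "g \<noteq> h"
      using cycle_on_obtain_edges[OF C card \<open>v \<in> V\<close>] .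
    have "e \<in># filter_mset (\<lambda>g. v \<in> g) ?C" "f \<in># filter_mset (\<lambda>g. v \<in> g) ?C"
      using that by auto
    then have "e \<in> {g, h}" "f \<in> {g, h}" unfolding gh(1) by simp_all
    then have "{e, f} = {g, h}" using False by blast
    moreover have "(g \<in># M \<longleftrightarrow> h \<in># M) \<longleftrightarrow> (g \<in># M' \<longleftrightarrow> h \<in># M')"
      using sides[OF refl gh] sides[OF eq gh] deg \<open>v \<in> V\<close> by simp
    ultimately show ?thesis using \<open>agree e\<close> unfolding agree_def by (auto simp: doubleton_eq_iff)
  qed (use that in simp)
  have edge: "e \<subseteq> V" "e \<noteq> {}" if "e \<in># ?C" for e
  proof -
    have "card e = 2" using cycle_on_multigraph[OF C] that by (auto simp: multigraph_def)
    then show "e \<noteq> {}" by auto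
  qed (use cycle_on_multigraph[OF C] that in \<open>auto simp: multigraph_def\<close>)
  obtain x where x: "x \<in> e0" "x \<in> V" using edge[OF e0(1)] by blast
  \<comment> \<open>Agreement spreads along walks from an end of \<open>e0\<close>, and
    connectedness carries it to all vertices.\<close>
  have at_vertex: "\<forall>e\<in>#?C. y \<in> e \<longrightarrow> agree e" if "(x, y) \<in> (adjacency ?C)\<^sup>*" for y
    using that
  proof (induction rule: rtrancl_induct)
    case base
    show ?case using agree_at[OF x(2,1) _ e0(1)] e0(2) by (auto simp: agree_def)
  next
    case (step y z)
    have yz: "{y, z} \<in># ?C" using step.hyps(2) by (simp add: adjacency_def)
    then have "agree {y, z}" using step.IH by blast
    moreover have "z \<in> V" using edge[OF yz] by blast
    ultimately show ?case using agree_at[of z "{y, z}"] yz by simp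
  qed
  have "agree e" if "e \<in># ?C" for e
  proof -
    obtain y where "y \<in> e" "y \<in> V" using edge[OF \<open>e \<in># ?C\<close>] by blast
    moreover have "(x, y) \<in> (adjacency ?C)\<^sup>*"
      using C x(2) \<open>y \<in> V\<close> by (simp add: cycle_on_def connected_graph_def)
    ultimately show ?thesis using at_vertex \<open>e \<in># ?C\<close> by blast
  qed
  moreover have "agree e" if "e \<notin># ?C" for e
    using that eq by (metis agree_def union_iff)
  ultimately have "set_mset M = set_mset M'" unfolding agree_def by blast
  moreover have "count K e = (if e \<in># K then 1 else 0)" if "count K e \<le> 1" for K :: "'a set multiset" and e
    using that by (auto simp: le_Suc_eq count_eq_zero_iff)
  ultimately show ?thesis using simple by (intro multiset_eqI) metis
qed


text \<open>The splittings for all choices of \<open>S\<close>, the centres with both edges in the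
  first colour, are collected in \<open>T\<close>. On at least three vertices the map to
  \<open>M + N\<close> is at most two to one.\<close>

lemma fact_le_twice_card_compatible:
  assumes G: "two_regular V G" and V: "card V \<ge> 2"
  shows "fact (card V - 2) \<le> 2 * card {C. compatible_cycle V G C}"
proof -
  have fin: "finite V" and ne: "V \<noteq> {}" using V by (auto intro: card_ge_0_finite)
  obtain U k where U: "U \<subseteq> V" "card V = 2 * k + card U" "k \<ge> 1" and ind: "independent_centres G U"
    and ex: "\<And>S. S \<subseteq> U \<Longrightarrow> \<exists>A. A \<subseteq># G \<and>
       (\<forall>v\<in>V. vertex_degree A v = (if v \<in> S then 2 else if v \<in> U then 0 else 1))"
    using two_regular_centres[OF G] ne by metis
  \<comment> \<open>Here \<open>k = Suc m\<close>, since the counting lemmas assume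
    \<open>2 * m + 2\<close> vertices besides the centres.\<close>
  then obtain m where m: "card V = 2 * Suc m + card U"
    by (cases k) auto
  have finU: "finite U" using U(1) fin by (rule finite_subset)
  from ex obtain A where A: "\<And>S. S \<subseteq> U \<Longrightarrow> A S \<subseteq># G"
    "\<And>S v. S \<subseteq> U \<Longrightarrow> v \<in> V \<Longrightarrow> vertex_degree (A S) v = (if v \<in> S then 2 else if v \<in> U then 0 else 1)"
    by metis
  define B where "B = (\<lambda>S. G - A S)"
  have AB: "A S + B S = G" if "S \<subseteq> U" for S
    using A(1)[OF that] by (simp add: B_def)
  have col: "edge_colouring V (A S) (B S) S (U - S)" if S: "S \<subseteq> U" for S
  proof -
    have sum: "vertex_degree (A S) v + vertex_degree (B S) v = 2" if "v \<in> V" for v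
      using G that by (simp add: two_regular_def flip: AB[OF S])
    then have "vertex_degree (B S) v = (if v \<in> U - S then 2 else if v \<in> S then 0 else 1)" if "v \<in> V" for v
      using A(2)[OF S that] sum[OF that] S by (auto split: if_splits)
    moreover have "S \<union> (U - S) = U" using S by blast
    ultimately show ?thesis
      using G U(1) S ind A(2)[OF S] unfolding edge_colouring_def AB[OF S] two_regular_def by auto
  qed
  let ?W = "\<lambda>S. splittings V (A S) (B S)"
  define T where "T = Sigma (Pow U) ?W"
  let ?C = "{C. compatible_cycle V G C}"
  have finC: "finite ?C"
    by (rule finite_subset[OF _ finite_cycles[of V]]) (auto simp: compatible_cycle_def)
  have "fact (2 * m) * pochhammer (2 * Suc m) (card U)
      = (\<Sum>S\<in>Pow U. fact (2 * m) * pochhammer (Suc m) (card S) * pochhammer (Suc m) (card (U - S)))"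
    using sum_Pow_pochhammer[OF finU, of "Suc m" "Suc m"]
    by (simp add: mult.assoc mult_2 flip: sum_distrib_left)
  also have "\<dots> \<le> (\<Sum>S\<in>Pow U. card (?W S))"
  proof (rule sum_mono)
    fix S assume "S \<in> Pow U"
    then have "S \<subseteq> U" "card U = card S + card (U - S)"
      using finU card_Diff_subset[of S U] card_mono[of U S] by (auto dest: finite_subset)
    then show "fact (2 * m) * pochhammer (Suc m) (card S) * pochhammer (Suc m) (card (U - S)) \<le> card (?W S)"
      using card_splittings_ge[OF col] m by simp
  qed
  also have "\<dots> = card T"
    unfolding T_def using finU by (subst card_SigmaI) (auto simp: finite_splittings)
  finally have T: "fact (card V - 2) \<le> card T"
    using fact_mult_pochhammer_ge[of m "card U"] m by simp
  have compat: "M + N \<in> ?C" if "(S, M, N) \<in> T" for S M N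
  proof -
    have S: "S \<subseteq> U" "(M, N) \<in> ?W S" using that by (auto simp: T_def)
    then have "cycle_on V (A S + M)" "cycle_on V (B S + N)" "cycle_on V (M + N)"
      by (auto simp: splittings_def)
    moreover have "G + (M + N) = (A S + M) + (B S + N)"
      unfolding AB[OF S(1), symmetric] by (simp add: ac_simps)
    ultimately show ?thesis
      unfolding compatible_cycle_def hamiltonian_decomposable_def by blast
  qed
  show ?thesis
  proof (cases "card V \<ge> 3")
    \<comment> \<open>On two vertices the factorial is 1, so a single compatible cycle suffices, and
      any element of \<open>T\<close> provides one.\<close>
    case False
    then have "card V - 2 = 0" by simp
    have "T \<noteq> {}" using T fact_gt_zero[of "card V - 2"] by (metis card.empty leD)
    then have "?C \<noteq> {}" using compat by fastforce
    then have "card ?C > 0" using finC by (simp add: card_gt_0_iff)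
    then show ?thesis unfolding \<open>card V - 2 = 0\<close> by simp
  next
    case True
    \<comment> \<open>The reference edge depends only on the multiset, so two splittings with the
      same union are compared at the same edge.\<close>
    define e0 :: "'a set multiset \<Rightarrow> 'a set" where "e0 = (\<lambda>C. SOME e. e \<in># C)"
    define h where "h = (\<lambda>(S :: 'a set, M, N). (M + N, e0 (M + N) \<in># M))"
    have "inj_on h T"
    proof (rule inj_onI)
      fix s t assume st: "s \<in> T" "t \<in> T" "h s = h t"
      obtain S M N where s: "s = (S, M, N)" by (metis surj_pair)
      obtain S' M' N' where t: "t = (S', M', N')" by (metis surj_pair)
      have S: "S \<subseteq> U" "(M, N) \<in> ?W S" "S' \<subseteq> U" "(M', N') \<in> ?W S'"
        using st s t by (auto simp: T_def)
      have eq: "M + N = M' + N'" "e0 (M + N) \<in># M \<longleftrightarrow> e0 (M + N) \<in># M'"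
        using st s t by (auto simp: h_def)
      have cyc: "cycle_on V (M + N)" using S(2) by (simp add: splittings_def)
      have "M + N \<noteq> {#}" using size_cycle_on[OF cyc] True by auto
      then have "e0 (M + N) \<in># M + N"
        unfolding e0_def by (metis multiset_nonemptyE someI)
      have deg: "vertex_degree M v = (if v \<in> S then 0 else if v \<in> U - S then 2 else 1)"
        "vertex_degree M' v = (if v \<in> S' then 0 else if v \<in> U - S' then 2 else 1)" if "v \<in> V" for v
        using splitting_left_degree[OF col[OF S(1)] S(2) that]
          splitting_left_degree[OF col[OF S(3)] S(4) that] by simp_all
      have "M = M'"
        by (rule splitting_determined[OF cyc True eq(1), of U])
          (use deg S eq(2) \<open>e0 (M + N) \<in># M + N\<close> in auto)
      moreover have "N = N'" using eq(1) \<open>M = M'\<close> by simp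
      \<comment> \<open>The set \<open>S\<close> consists of the vertices at which \<open>M\<close>
        has degree 0, so \<open>M\<close> determines it.\<close>
      moreover have "v \<in> S \<longleftrightarrow> v \<in> S'" for v
      proof (cases "v \<in> V")
        case True
        then show ?thesis using deg[of v] \<open>M = M'\<close> by (auto split: if_splits)
      qed (use S U in auto)
      ultimately show "s = t" using s t by auto
    qed
    moreover have "h ` T \<subseteq> ?C \<times> UNIV"
      using compat by (auto simp: h_def)
    \<comment> \<open>The Boolean component, which records the side of the reference edge, accounts
      for the factor 2.\<close>
    ultimately have "card T \<le> card (?C \<times> (UNIV :: bool set))"
      using finC by (intro card_inj_on_le) auto
    then show ?thesis using T by (simp add: card_cartesian_product)
  qed
qed

theorem theorem1p3:
  fixes V :: "'a set" and G :: "'a set multiset" and n :: nat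
  assumes "two_regular V G" and "card V = n" and "n \<ge> 2"
  shows "real (card {C. compatible_cycle V G C}) \<ge> fact (n - 2) / 4 \<and>
         ((\<forall>W D. cycle_of V G W D \<longrightarrow> even (size D)) \<longrightarrow>
           real (card {C. compatible_cycle V G C}) \<ge> fact (n - 2) / 2)"
proof -
  have "(fact (n - 2) :: nat) \<le> 2 * card {C. compatible_cycle V G C}"
    using fact_le_twice_card_compatible[OF assms(1)] assms by simp
  then have "real (fact (n - 2)) \<le> real (2 * card {C. compatible_cycle V G C})"
    by (rule of_nat_mono)
  then have "(fact (n - 2) :: real) \<le> 2 * real (card {C. compatible_cycle V G C})"
    by simp
  \<comment> \<open>Positivity lets the bound with denominator 4 follow from the one with
    denominator 2.\<close>
  moreover have "(fact (n - 2) :: real) > 0" by simp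
  ultimately show ?thesis by linarith
qed

end
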